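(* Let $\mu$ be a probability measure on the unit circle $\mathbb{T}$ with infinite support, and let $(x_n)_{n\ge 0}$ be its sequence of orthonormal Laurent polynomials (obtained from $1,z^{-1},z,z^{-2},z^2,\dots$). Then there exists a linear differential operator $D$ of order $r$ with $1\le r\le 2$ such that every $x_n$, $n\ge0$, is an eigenfunction of $D$ (i.e. $Dx_n=\lambda_nx_n$ for some $\lambda_n\in\mathbb{C}$) if and only if $\mu$ is the (normalized) Lebesgue measure on $\mathbb{T}$.
   Context: $\mathbb{T}=\{z\in\mathbb{C}:|z|=1\}$. For a probability measure $\mu$ on $\mathbb{T}$ with infinite support, $(x_n)_{n\ge0}$ denotes the sequence of orthonormal Laurent polynomials (OLP) produced by Gram–Schmidt orthonormalization (with positive leading coefficients) in $L^2_\mu$ of the ordered sequence $1,z^{-1},z,z^{-2},z^2,\dots$. For the normalized Lebesgue (arc length) measure, $x_{2m-1}(z)=z^{-m}$ and $x_{2m}(z)=z^m$. A linear differential operator of order $r$ is $D=\sum_{k=0}^r D_k(z)\frac{d^k}{dz^k}$, with $D_k$ complex functions on $\mathbb{C}\setminus\{0\}$ and $D_r$ not identically zero; when all $x_n$ are eigenfunctions of $D$, $D$ maps the space $\mathbb{C}[z,z^{-1}]$ of Laurent polynomials into itself and the $D_k$ are necessarily Laurent polynomials. *)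

theory Defs
  imports "HOL-Probability.Probability"
begin

abbreviation unit_circle :: "complex set" where
  "unit_circle \<equiv> sphere 0 1"

definition circle_borel :: "complex measure" where
  "circle_borel = restrict_space borel unit_circle"

definition measure_support :: "'a::topological_space measure \<Rightarrow> 'a set" where
  "measure_support M =
     {x \<in> space M. \<forall>U. open U \<and> x \<in> U \<longrightarrow> emeasure M (U \<inter> space M) > 0}"

definition lebesgue_circle :: "complex measure" where
  "lebesgue_circle = distr (uniform_measure lborel {0..<2 * pi}) circle_borel cis"

definition L2_inner ::
  "complex measure \<Rightarrow> (complex \<Rightarrow> complex) \<Rightarrow> (complex \<Rightarrow> complex) \<Rightarrow> complex" where
  "L2_inner M f g = (\<integral>z. f z * cnj (g z) \<partial>M)"

definition L2_norm :: "complex measure \<Rightarrow> (complex \<Rightarrow> complex) \<Rightarrow> real" where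
  "L2_norm M f = sqrt (\<integral>z. (cmod (f z))\<^sup>2 \<partial>M)"

text \<open>The exponents 0, -1, 1, -2, 2, \<dots>.\<close>

definition laurent_exponent :: "nat \<Rightarrow> int" where
  "laurent_exponent n = (if even n then int (n div 2) else - int ((n + 1) div 2))"

text \<open>
  Gram-Schmidt in \<open>L\<^sup>2(M)\<close>: the residual of the next monomial is divided by its (positive) norm,
  so the leading coefficient of \<open>olp M n\<close>, i.e. the coefficient of
  \<open>z powi laurent_exponent n\<close>, is positive when \<open>M\<close> has infinite support.
  Laurent polynomials are functions of \<open>z\<close>; their values at \<open>0\<close> carry no meaning.
\<close>

fun olp :: "complex measure \<Rightarrow> nat \<Rightarrow> complex \<Rightarrow> complex" where
  "olp M n =
     (let e = (\<lambda>z. z powi laurent_exponent n);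
          u = (\<lambda>z. e z - (\<Sum>k<n. L2_inner M e (olp M k) * olp M k z))
      in (\<lambda>z. u z / complex_of_real (L2_norm M u)))"

declare olp.simps [simp del]

text \<open>
  A linear differential operator is given by its coefficient functions \<open>D 0, \<dots>, D r\<close>, arbitrary
  functions on the punctured plane (values at \<open>0\<close> and beyond index \<open>r\<close> are ignored).
\<close>

definition has_diff_order :: "(nat \<Rightarrow> complex \<Rightarrow> complex) \<Rightarrow> nat \<Rightarrow> bool" where
  "has_diff_order D r \<longleftrightarrow> (\<exists>z. z \<noteq> 0 \<and> D r z \<noteq> 0)"

definition diff_op ::
  "(nat \<Rightarrow> complex \<Rightarrow> complex) \<Rightarrow> nat \<Rightarrow> (complex \<Rightarrow> complex) \<Rightarrow> complex \<Rightarrow> complex" where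
  "diff_op D r f z = (\<Sum>k\<le>r. D k z * (deriv ^^ k) f z)"

definition is_eigenfunction ::
  "(nat \<Rightarrow> complex \<Rightarrow> complex) \<Rightarrow> nat \<Rightarrow> (complex \<Rightarrow> complex) \<Rightarrow> bool" where
  "is_eigenfunction D r f \<longleftrightarrow> (\<exists>c. \<forall>z. z \<noteq> 0 \<longrightarrow> diff_op D r f z = c * f z)"

end

theory Submission imports Defs begin

text \<open>
  An operator that has every orthonormal Laurent polynomial as an eigenfunction preserves each of the
  spaces spanned by the first \<open>n + 1\<close> monomials of the sequence \<open>1, 1/z, z, 1/z\<^sup>2, z\<^sup>2, \<dots>\<close>. For an
  operator \<open>D\<close> of order at most two this is a severe restriction. Write \<open>D z\<^sup>j = q\<^sub>j(z) z\<^sup>j\<close>; then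
  \<open>q\<^sub>j = D\<^sub>0 + j (D\<^sub>1 / z) + j (j - 1) (D\<^sub>2 / z\<^sup>2)\<close> is a quadratic polynomial in \<open>j\<close>, so any four of the
  \<open>q\<^sub>j\<close> with consecutive \<open>j\<close> satisfy the linear relation saying that their third difference vanishes.
  Invariance gives that \<open>q\<^sub>j\<close> has only exponents \<open>\<le> 0\<close> for \<open>j \<ge> 0\<close> and only exponents \<open>\<ge> 0\<close> for
  \<open>j \<le> 0\<close>. The relation among \<open>q\<^sub>-\<^sub>1, \<dots>, q\<^sub>2\<close> and the one among \<open>q\<^sub>-\<^sub>2, \<dots>, q\<^sub>1\<close> transfer these bounds to
  \<open>q\<^sub>-\<^sub>1\<close> and \<open>q\<^sub>1\<close>, which are therefore constant. Hence \<open>D\<close> is diagonal on monomials,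
  \<open>D z\<^sup>j = \<kappa>\<^sub>j z\<^sup>j\<close> with \<open>\<kappa>\<^sub>j = a + b j + c j (j - 1)\<close> and \<open>(b, c) \<noteq> 0\<close>
  (lemmas \<open>diagonal_of_symmetric_spans\<close> and \<open>eigenoperator_diagonal\<close>).

  Only monomials with the same \<open>\<kappa>\<close> can now occur together in an eigenfunction. A quadratic
  takes the same value at distinct \<open>i\<close> and \<open>j\<close> only if \<open>i + j\<close> equals one fixed number. Let \<open>m \<ge> 1\<close>.
  If \<open>\<kappa>\<^sub>m\<close> were equal to \<open>\<kappa>\<^sub>i\<close> for an exponent \<open>i\<close> that precedes \<open>m\<close>, that number would be
  \<open>i + m \<ge> 0\<close>; if the value of \<open>\<kappa>\<close> at \<open>-m\<close> were equal to \<open>\<kappa>\<^sub>j\<close> for an exponent \<open>j\<close> that precedes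
  \<open>-m\<close>, it would be \<open>j - m < 0\<close>. Both cannot happen, so one of \<open>z\<^sup>m\<close>, \<open>1/z\<^sup>m\<close> is, up to a factor, an orthonormal Laurent
  polynomial, and is orthogonal to \<open>1\<close>. As the moments of order \<open>m\<close> and \<open>-m\<close> are complex conjugates,
  both vanish (lemma \<open>moments_zero_of_diagonal\<close>). The moments of the measure are those of the Lebesgue
  measure, and by the Stone-Weierstrass theorem they determine it (lemma
  \<open>circle_measure_eqI_moments\<close>).

  Conversely, for the Lebesgue measure the orthonormal Laurent polynomials are the monomials, and
  these are eigenfunctions of \<open>z d/dz\<close>.
\<close>

section \<open>Laurent polynomials\<close>

text \<open>
  Membership constrains a function off the origin only, since the value \<open>0 powi j = 0\<close> for
  \<open>j \<noteq> 0\<close> is a convention without meaning for Laurent polynomials.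
\<close>

definition laurent_span :: "int set \<Rightarrow> (complex \<Rightarrow> complex) set" where
  "laurent_span A = {f. \<exists>c. \<forall>z. z \<noteq> 0 \<longrightarrow> f z = (\<Sum>j\<in>A. c j * z powi j)}"

lemma laurent_span_expand:
  assumes "f \<in> laurent_span A" "A \<subseteq> B" "finite B"
  obtains c where "\<And>j. j \<notin> A \<Longrightarrow> c j = 0"
    and "\<And>z. z \<noteq> 0 \<Longrightarrow> f z = (\<Sum>j\<in>B. c j * z powi j)"
proof -
  obtain c where c: "\<And>z. z \<noteq> 0 \<Longrightarrow> f z = (\<Sum>j\<in>A. c j * z powi j)"
    using assms(1) by (auto simp: laurent_span_def)
  define d where "d = (\<lambda>j. if j \<in> A then c j else 0)"
  have "f z = (\<Sum>j\<in>B. d j * z powi j)" if "z \<noteq> 0" for z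
    unfolding c[OF that] d_def using assms by (intro sum.mono_neutral_cong_left) auto
  moreover have "d j = 0" if "j \<notin> A" for j
    using that by (simp add: d_def)
  ultimately show ?thesis by (intro that[of d])
qed

lemma laurent_spanI:
  assumes "\<And>z. z \<noteq> 0 \<Longrightarrow> f z = (\<Sum>j\<in>A. c j * z powi j)"
  shows "f \<in> laurent_span A"
  using assms by (auto simp: laurent_span_def)

lemma laurent_span_cong:
  assumes "\<And>z. z \<noteq> 0 \<Longrightarrow> f z = g z" "g \<in> laurent_span A"
  shows "f \<in> laurent_span A"
  using assms by (auto simp: laurent_span_def)

lemma laurent_span_mono:
  assumes "f \<in> laurent_span A" "A \<subseteq> B" "finite B"
  shows "f \<in> laurent_span B"
proof -
  obtain c where "\<And>z. z \<noteq> 0 \<Longrightarrow> f z = (\<Sum>j\<in>B. c j * z powi j)"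
    using laurent_span_expand[OF assms] by blast
  then show ?thesis by (rule laurent_spanI)
qed

lemma laurent_span_monomial:
  assumes "j \<in> A" "finite A"
  shows "(\<lambda>z. z powi j) \<in> laurent_span A"
proof (rule laurent_spanI[where c = "\<lambda>i. if i = j then 1 else 0"])
  fix z :: complex
  have "(\<Sum>i\<in>A. (if i = j then 1 else 0) * z powi i) = (\<Sum>i\<in>A. if i = j then z powi i else 0)"
    by (rule sum.cong) auto
  with assms show "z powi j = (\<Sum>i\<in>A. (if i = j then 1 else 0) * z powi i)"
    by simp
qed

lemma monomial_laurent_span: "(\<lambda>z. z powi j) \<in> laurent_span {j}"
  by (rule laurent_span_monomial) auto

lemma laurent_span_scale:
  assumes "f \<in> laurent_span A"
  shows "(\<lambda>z. a * f z) \<in> laurent_span A"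
proof -
  obtain c where c: "\<And>z. z \<noteq> 0 \<Longrightarrow> f z = (\<Sum>j\<in>A. c j * z powi j)"
    using assms(1) by (auto simp: laurent_span_def)
  show ?thesis
    by (rule laurent_spanI[where c = "\<lambda>j. a * c j"])
       (simp only: c sum_distrib_left mult.assoc not_False_eq_True)
qed

lemma laurent_span_add:
  assumes "f \<in> laurent_span A" "g \<in> laurent_span A"
  shows "(\<lambda>z. f z + g z) \<in> laurent_span A"
proof -
  obtain c where c: "\<And>z. z \<noteq> 0 \<Longrightarrow> f z = (\<Sum>j\<in>A. c j * z powi j)"
    using assms(1) by (auto simp: laurent_span_def)
  obtain d where d: "\<And>z. z \<noteq> 0 \<Longrightarrow> g z = (\<Sum>j\<in>A. d j * z powi j)"
    using assms(2) by (auto simp: laurent_span_def)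
  show ?thesis
    by (rule laurent_spanI[where c = "\<lambda>j. c j + d j"])
       (simp only: c d sum.distrib distrib_right not_False_eq_True)
qed

lemma laurent_span_zero: "(\<lambda>z. 0) \<in> laurent_span A"
  by (rule laurent_spanI[where c = "\<lambda>_. 0"]) simp

lemma laurent_span_sum:
  assumes "\<And>k. k \<in> K \<Longrightarrow> f k \<in> laurent_span A"
  shows "(\<lambda>z. \<Sum>k\<in>K. f k z) \<in> laurent_span A"
  using assms
proof (induction K rule: infinite_finite_induct)
  case (insert x F)
  then show ?case using laurent_span_add[of "f x" A "\<lambda>z. \<Sum>k\<in>F. f k z"] by simp
qed (simp_all add: laurent_span_zero)

lemma laurent_span_diff:
  assumes "f \<in> laurent_span A" "g \<in> laurent_span A"
  shows "(\<lambda>z. f z - g z) \<in> laurent_span A"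
  using laurent_span_add[OF assms(1) laurent_span_scale[OF assms(2), of "-1"]] by simp

lemma laurent_span_shift:
  assumes "f \<in> laurent_span A"
  shows "(\<lambda>z. z powi k * f z) \<in> laurent_span ((+) k ` A)"
proof -
  obtain c where c: "\<And>z. z \<noteq> 0 \<Longrightarrow> f z = (\<Sum>j\<in>A. c j * z powi j)"
    using assms(1) by (auto simp: laurent_span_def)
  show ?thesis
  proof (rule laurent_spanI[where c = "\<lambda>j. c (j - k)"])
    fix z :: complex assume z: "z \<noteq> 0"
    have "(\<Sum>j\<in>(+) k ` A. c (j - k) * z powi j) = (\<Sum>j\<in>A. c j * z powi (k + j))"
      by (simp add: sum.reindex)
    also have "\<dots> = z powi k * f z"
      using z by (simp add: c sum_distrib_left power_int_add mult.left_commute)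
    finally show "z powi k * f z = (\<Sum>j\<in>(+) k ` A. c (j - k) * z powi j)" by simp
  qed
qed

text \<open>
  Multiplying by \<open>z\<^sup>N\<close> with \<open>N\<close> large turns the Laurent polynomial into an ordinary polynomial with the
  same nonzero roots, which has finitely many of them unless all coefficients vanish.
\<close>

lemma laurent_coeffs_zero:
  fixes c :: "int \<Rightarrow> complex"
  assumes fin: "finite A" and inf: "infinite {z. z \<noteq> 0 \<and> (\<Sum>j\<in>A. c j * z powi j) = 0}"
    and j: "j \<in> A"
  shows "c j = 0"
proof (rule ccontr)
  assume cj: "c j \<noteq> 0"
  obtain N :: nat where N: "\<And>i. i \<in> A \<Longrightarrow> \<bar>i\<bar> \<le> int N"
  proof
    show "\<bar>i\<bar> \<le> int (nat (\<Sum>i\<in>A. \<bar>i\<bar>))" if "i \<in> A" for i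
      using member_le_sum[OF that, of "abs"] fin by simp
  qed
  define d where "d = (\<lambda>i. if int i - int N \<in> A then c (int i - int N) else 0)"
  have eq: "(\<Sum>i\<le>2*N. d i * z ^ i) = z ^ N * (\<Sum>j\<in>A. c j * z powi j)" if z: "z \<noteq> 0" for z
  proof -
    have "z ^ N * (\<Sum>j\<in>A. c j * z powi j) = (\<Sum>j\<in>A. c j * z powi (j + int N))"
      using z by (simp add: sum_distrib_left power_int_add mult_ac)
    also have "\<dots> = (\<Sum>i\<in>(\<lambda>j. nat (j + int N)) ` A. d i * z ^ i)"
    proof (subst sum.reindex)
      show "inj_on (\<lambda>j. nat (j + int N)) A"
      proof (rule inj_onI)
        fix x y assume "x \<in> A" "y \<in> A" "nat (x + int N) = nat (y + int N)"
        then show "x = y" using N[of x] N[of y] by linarith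
      qed
      show "(\<Sum>j\<in>A. c j * z powi (j + int N))
          = (\<Sum>x\<in>A. ((\<lambda>i. d i * z ^ i) \<circ> (\<lambda>j. nat (j + int N))) x)"
      proof (rule sum.cong[OF refl])
        fix x assume x: "x \<in> A"
        then have "x + int N \<ge> 0" using N[OF x] by linarith
        then show "c x * z powi (x + int N) = ((\<lambda>i. d i * z ^ i) \<circ> (\<lambda>j. nat (j + int N))) x"
          using x by (simp add: d_def power_int_def)
      qed
    qed
    also have "\<dots> = (\<Sum>i\<le>2*N. d i * z ^ i)"
    proof (rule sum.mono_neutral_left)
      show "(\<lambda>j. nat (j + int N)) ` A \<subseteq> {..2 * N}"
      proof safe
        fix x assume "x \<in> A"
        then show "nat (x + int N) \<le> 2 * N" using N[of x] by linarith
      qed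
      show "\<forall>i\<in>{..2 * N} - (\<lambda>j. nat (j + int N)) ` A. d i * z ^ i = 0"
      proof
        fix i assume i: "i \<in> {..2 * N} - (\<lambda>j. nat (j + int N)) ` A"
        have "i = nat ((int i - int N) + int N)" by simp
        with i have "int i - int N \<notin> A" by blast
        then show "d i * z ^ i = 0" by (simp add: d_def)
      qed
    qed simp
    finally show ?thesis by simp
  qed
  have "\<exists>i\<le>2*N. d i \<noteq> 0"
    using j cj N[OF j] by (intro exI[of _ "nat (j + int N)"]) (auto simp: d_def)
  then have "finite {z. (\<Sum>i\<le>2*N. d i * z ^ i) = 0}"
    by (simp add: polyfun_finite_roots)
  moreover have "{z. z \<noteq> 0 \<and> (\<Sum>j\<in>A. c j * z powi j) = 0} \<subseteq> {z. (\<Sum>i\<le>2*N. d i * z ^ i) = 0}"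
    using eq by auto
  ultimately show False
    using inf finite_subset by blast
qed

lemma infinite_nonzero_complex: "infinite {z :: complex. z \<noteq> 0}"
proof -
  have "{z :: complex. z \<noteq> 0} = UNIV - {0}" by auto
  then show ?thesis by (simp add: infinite_UNIV_char_0)
qed

lemma laurent_span_zeros_finite:
  assumes f: "f \<in> laurent_span A" and fin: "finite A" and w: "w \<noteq> 0" "f w \<noteq> 0"
  shows "finite {z. z \<noteq> 0 \<and> f z = 0}"
proof (rule ccontr)
  assume inf: "infinite {z. z \<noteq> 0 \<and> f z = 0}"
  obtain c where c: "\<And>z. z \<noteq> 0 \<Longrightarrow> f z = (\<Sum>j\<in>A. c j * z powi j)"
    using f by (auto simp: laurent_span_def)
  have "{z. z \<noteq> 0 \<and> f z = 0} = {z. z \<noteq> 0 \<and> (\<Sum>j\<in>A. c j * z powi j) = 0}"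
    using c by auto
  with inf have inf': "infinite {z. z \<noteq> 0 \<and> (\<Sum>j\<in>A. c j * z powi j) = 0}"
    by simp
  have "c j = 0" if "j \<in> A" for j
    by (rule laurent_coeffs_zero[OF fin inf' that])
  with c[OF w(1)] w(2) show False by simp
qed

lemma laurent_coeffs_unique:
  fixes c d :: "int \<Rightarrow> complex"
  assumes fin: "finite A"
    and eq: "\<And>z. z \<noteq> 0 \<Longrightarrow> (\<Sum>j\<in>A. c j * z powi j) = (\<Sum>j\<in>A. d j * z powi j)"
    and j: "j \<in> A"
  shows "c j = d j"
proof -
  have "{z. z \<noteq> 0 \<and> (\<Sum>j\<in>A. (c j - d j) * z powi j) = 0} = {z. z \<noteq> 0}"
    using eq by (auto simp: left_diff_distrib sum_subtractf)
  then have "c j - d j = 0"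
    using laurent_coeffs_zero[OF fin, of "\<lambda>j. c j - d j"] infinite_nonzero_complex j by simp
  then show ?thesis by simp
qed

text \<open>
  This is uniqueness of coefficients in the form in which it is used: two bounds for the exponents
  of one function can be combined, without naming the coefficients.
\<close>

lemma laurent_span_Int:
  assumes "f \<in> laurent_span A" "f \<in> laurent_span B" "finite A" "finite B"
  shows "f \<in> laurent_span (A \<inter> B)"
proof -
  have fin: "finite (A \<union> B)" using assms by simp
  obtain c where c: "\<And>j. j \<notin> A \<Longrightarrow> c j = 0"
      "\<And>z. z \<noteq> 0 \<Longrightarrow> f z = (\<Sum>j\<in>A \<union> B. c j * z powi j)"
    using laurent_span_expand[OF assms(1) _ fin] by blast
  obtain d where d: "\<And>j. j \<notin> B \<Longrightarrow> d j = 0"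
      "\<And>z. z \<noteq> 0 \<Longrightarrow> f z = (\<Sum>j\<in>A \<union> B. d j * z powi j)"
    using laurent_span_expand[OF assms(2) _ fin] by blast
  have cd: "c j = d j" if "j \<in> A \<union> B" for j
    using laurent_coeffs_unique[OF fin _ that, of c d] c(2) d(2) by simp
  have "(\<Sum>j\<in>A \<inter> B. c j * z powi j) = (\<Sum>j\<in>A \<union> B. c j * z powi j)" for z
  proof (rule sum.mono_neutral_left[OF fin])
    show "\<forall>j\<in>A \<union> B - A \<inter> B. c j * z powi j = 0"
      using c(1) d(1) cd by fastforce
  qed auto
  then show ?thesis
    using c(2) by (intro laurent_spanI[where c = c]) simp
qed

lemma laurent_span_empty:
  assumes "f \<in> laurent_span {}" "z \<noteq> 0"
  shows "f z = 0"
  using assms by (auto simp: laurent_span_def)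

lemma laurent_span_constant:
  assumes "f \<in> laurent_span {0}" "z \<noteq> 0"
  shows "f z = f 1"
  using assms by (auto simp: laurent_span_def)

section \<open>The ordering of the exponents\<close>

lemma laurent_exponent_inj:
  "laurent_exponent m = laurent_exponent n \<Longrightarrow> m = n"
  unfolding laurent_exponent_def by (auto split: if_splits elim!: evenE oddE)

lemma laurent_exponent_abs_mono:
  "m \<le> n \<Longrightarrow> \<bar>laurent_exponent m\<bar> \<le> \<bar>laurent_exponent n\<bar>"
  unfolding laurent_exponent_def by (auto split: if_splits elim!: evenE oddE)

lemma laurent_exponent_even: "laurent_exponent (2 * m) = int m"
  by (simp add: laurent_exponent_def)

lemma laurent_exponent_odd: "laurent_exponent (2 * m + 1) = - int (m + 1)"
  by (simp add: laurent_exponent_def)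

section \<open>Laurent polynomials on the circle\<close>

lemma laurent_span_continuous_on:
  assumes "f \<in> laurent_span A"
  shows "continuous_on unit_circle f"
proof -
  obtain c where c: "\<And>z. z \<noteq> 0 \<Longrightarrow> f z = (\<Sum>j\<in>A. c j * z powi j)"
    using assms by (auto simp: laurent_span_def)
  have "continuous_on unit_circle (\<lambda>z. \<Sum>j\<in>A. c j * z powi j)"
    by (intro continuous_intros) auto
  moreover have "f z = (\<Sum>j\<in>A. c j * z powi j)" if "z \<in> unit_circle" for z
    using that by (intro c) auto
  ultimately show ?thesis
    using continuous_on_cong[OF refl, of unit_circle f] by simp
qed

lemma cnj_powi_circle:
  assumes "cmod z = 1"
  shows "cnj (z powi k) = z powi (- k)"
proof -
  have "z powi k * cnj (z powi k) = 1"
    using assms complex_norm_square[of "z powi k"] by (simp add: norm_power_int)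
  then show ?thesis by (simp add: power_int_minus inverse_unique)
qed

section \<open>Gram-Schmidt for a probability measure on the circle\<close>

locale circle_prob_space = prob_space M for M :: "complex measure" +
  assumes sets_circle: "sets M = sets circle_borel"
begin

lemma space_circle: "space M = unit_circle"
  using sets_eq_imp_space_eq[OF sets_circle] by (simp add: circle_borel_def space_restrict_space)

lemma integrable_continuous:
  fixes f :: "complex \<Rightarrow> 'b :: {banach, second_countable_topology}"
  assumes "continuous_on unit_circle f"
  shows "integrable M f"
proof -
  have "bounded (f ` unit_circle)"
    by (intro compact_imp_bounded compact_continuous_image assms) simp
  then obtain B where B: "\<And>z. z \<in> unit_circle \<Longrightarrow> norm (f z) \<le> B"
    unfolding bounded_iff by blast
  have "f \<in> borel_measurable circle_borel"
    unfolding circle_borel_def by (rule borel_measurable_continuous_on_restrict[OF assms])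
  then have "f \<in> borel_measurable M"
    using measurable_cong_sets[OF sets_circle refl] by blast
  moreover have "AE z in M. norm (f z) \<le> B"
    by (rule AE_I2) (use B space_circle in auto)
  ultimately show ?thesis
    by (intro integrable_const_bound)
qed

lemma integrable_laurent:
  assumes "f \<in> laurent_span A"
  shows "integrable M f"
  by (rule integrable_continuous[OF laurent_span_continuous_on[OF assms]])

definition residual :: "nat \<Rightarrow> complex \<Rightarrow> complex" where
  "residual n z = z powi laurent_exponent n
     - (\<Sum>k<n. L2_inner M (\<lambda>z. z powi laurent_exponent n) (olp M k) * olp M k z)"

lemma olp_eq: "olp M n z = residual n z / complex_of_real (L2_norm M (residual n))"
  by (subst olp.simps) (simp add: Let_def residual_def[abs_def])

lemma olp_span: "olp M n \<in> laurent_span (laurent_exponent ` {..n})"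
proof (induction n rule: less_induct)
  case (less n)
  let ?E = "laurent_exponent ` {..n}"
  have "olp M k \<in> laurent_span ?E" if "k < n" for k
    using that by (intro laurent_span_mono[OF less.IH]) auto
  then have "residual n \<in> laurent_span ?E"
    unfolding residual_def[abs_def]
    by (intro laurent_span_diff laurent_span_sum laurent_span_scale laurent_span_monomial) auto
  from laurent_span_scale[OF this, of "1 / complex_of_real (L2_norm M (residual n))"]
  show ?case
    by (rule laurent_span_cong[rotated]) (simp add: olp_eq)
qed

lemma earlier_span:
  "(\<lambda>z. \<Sum>k<n. h k * olp M k z) \<in> laurent_span (laurent_exponent ` {..<n})"
  by (intro laurent_span_sum laurent_span_scale laurent_span_mono[OF olp_span]) auto

lemma residual_span: "residual n \<in> laurent_span (laurent_exponent ` {..n})"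
  unfolding residual_def[abs_def]
  by (intro laurent_span_diff laurent_span_monomial laurent_span_mono[OF earlier_span]) auto

text \<open>
  The residual is the monomial minus a combination of earlier monomials. If the exponent of that monomial
  were missing from \<open>A\<close>, moving the combination to the other side would write the monomial as a
  combination of different monomials.
\<close>

lemma residual_leading:
  assumes "residual n \<in> laurent_span A" "finite A"
  shows "laurent_exponent n \<in> A"
proof (rule ccontr)
  assume n: "laurent_exponent n \<notin> A"
  let ?e = "\<lambda>z::complex. z powi laurent_exponent n"
  let ?L = "laurent_exponent ` {..<n}"
  let ?w = "\<lambda>z. \<Sum>k<n. L2_inner M ?e (olp M k) * olp M k z"
  have "(\<lambda>z. residual n z + ?w z) \<in> laurent_span (A \<union> ?L)"
    using assms by (intro laurent_span_add laurent_span_mono[OF assms(1)]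
        laurent_span_mono[OF earlier_span]) auto
  then have "?e \<in> laurent_span (A \<union> ?L)"
    by (rule laurent_span_cong[rotated]) (simp add: residual_def)
  then have "?e \<in> laurent_span ({laurent_exponent n} \<inter> (A \<union> ?L))"
    using assms(2) by (intro laurent_span_Int monomial_laurent_span) auto
  also have "{laurent_exponent n} \<inter> (A \<union> ?L) = {}"
    using n by (auto dest: laurent_exponent_inj)
  finally show False
    using laurent_span_empty[of ?e 1] by simp
qed

text \<open>
  A continuous function of norm zero vanishes almost everywhere; around a support point where it
  did not vanish, it would be nonzero on a neighbourhood of positive measure.
\<close>

lemma support_subset_zeros:
  assumes f: "continuous_on unit_circle f" and 0: "L2_norm M f = 0"
    and z: "z \<in> measure_support M"
  shows "f z = 0"
proof (rule ccontr)
  assume nz: "f z \<noteq> 0"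
  have cont: "continuous_on unit_circle (\<lambda>z. (cmod (f z))\<^sup>2)"
    by (intro continuous_intros f)
  have "(\<integral>z. (cmod (f z))\<^sup>2 \<partial>M) = 0"
    using 0 by (simp add: L2_norm_def)
  then have ae: "AE z in M. (cmod (f z))\<^sup>2 = 0"
    by (subst (asm) integral_nonneg_eq_0_iff_AE[OF integrable_continuous[OF cont]]) auto
  have "open (- {0 :: complex})" by auto
  with f have "\<exists>U. open U \<and> U \<inter> unit_circle = f -` (- {0}) \<inter> unit_circle"
    by (simp only: continuous_on_open_invariant)
  then obtain U where U: "open U" "U \<inter> unit_circle = f -` (- {0}) \<inter> unit_circle"
    by (elim exE conjE)
  have U_iff: "w \<in> U \<longleftrightarrow> f w \<noteq> 0" if "w \<in> space M" for w
    using U(2) that unfolding space_circle by blast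
  then have "U \<inter> space M = {z \<in> space M. f z \<noteq> 0}"
    by blast
  moreover have "emeasure M {z \<in> space M. f z \<noteq> 0} = 0"
    using ae by (intro emeasure_eq_0_AE) auto
  moreover have "z \<in> U"
    using z nz U_iff by (simp add: measure_support_def)
  moreover have "emeasure M (U \<inter> space M) > 0"
    using z U(1) \<open>z \<in> U\<close> by (simp add: measure_support_def)
  ultimately show False by simp
qed

text \<open>
  Infinite support keeps Gram-Schmidt from degenerating: a nonzero Laurent polynomial has finitely many
  zeros, so it cannot vanish on the whole support.
\<close>

lemma L2_norm_residual:
  assumes "infinite (measure_support M)"
  shows "L2_norm M (residual n) \<noteq> 0"
proof
  assume 0: "L2_norm M (residual n) = 0"
  have "\<exists>w. w \<noteq> 0 \<and> residual n w \<noteq> 0"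
  proof (rule ccontr)
    assume "\<nexists>w. w \<noteq> 0 \<and> residual n w \<noteq> 0"
    then have "residual n \<in> laurent_span {}"
      by (auto simp: laurent_span_def)
    from residual_leading[OF this] show False by simp
  qed
  then have "finite {z. z \<noteq> 0 \<and> residual n z = 0}"
    using laurent_span_zeros_finite[OF residual_span[of n]] by auto
  moreover have "measure_support M \<subseteq> {z. z \<noteq> 0 \<and> residual n z = 0}"
    using support_subset_zeros[OF laurent_span_continuous_on[OF residual_span] 0]
    by (auto simp: measure_support_def space_circle)
  ultimately show False
    using assms finite_subset by blast
qed

lemma olp_0: "olp M 0 = (\<lambda>z. 1)"
proof -
  have "residual 0 = (\<lambda>z. 1)"
    by (simp add: residual_def[abs_def] laurent_exponent_def)
  then show ?thesis
    using prob_space by (simp add: fun_eq_iff olp_eq L2_norm_def)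
qed

text \<open>
  This is orthogonality to \<open>x\<^sub>0 = 1\<close>, the relation that makes moments vanish later. By induction, only
  the term \<open>k = 0\<close> of the Gram-Schmidt sum has a nonzero integral, and it cancels the integral of the
  monomial.
\<close>

lemma integral_olp: "n > 0 \<Longrightarrow> (\<integral>z. olp M n z \<partial>M) = 0"
proof (induction n rule: less_induct)
  case (less n)
  let ?e = "\<lambda>z::complex. z powi laurent_exponent n"
  let ?h = "\<lambda>k. L2_inner M ?e (olp M k)"
  have int: "integrable M (olp M k)" for k
    by (rule integrable_laurent[OF olp_span])
  have "(\<Sum>k<n. ?h k * (\<integral>z. olp M k z \<partial>M)) = (\<Sum>k\<in>{0}. ?h k * (\<integral>z. olp M k z \<partial>M))"
    using less by (intro sum.mono_neutral_right) auto
  also have "\<dots> = (\<integral>z. ?e z \<partial>M)"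
    using prob_space by (simp add: olp_0 L2_inner_def)
  finally have "(\<integral>z. residual n z \<partial>M) = 0"
    unfolding residual_def
    using int integrable_laurent[OF monomial_laurent_span]
    by (simp add: integral_sum)
  then show ?case
    by (simp add: olp_eq)
qed

end

section \<open>Moments determine a measure on the circle\<close>

lemma laurent_span_mult:
  assumes f: "f \<in> laurent_span A" "finite A" and g: "g \<in> laurent_span B" "finite B"
  shows "(\<lambda>z. f z * g z) \<in> laurent_span ((\<lambda>(i, j). i + j) ` (A \<times> B))"
proof -
  obtain c where c: "\<And>z. z \<noteq> 0 \<Longrightarrow> f z = (\<Sum>j\<in>A. c j * z powi j)"
    using f by (auto simp: laurent_span_def)
  obtain d where d: "\<And>z. z \<noteq> 0 \<Longrightarrow> g z = (\<Sum>j\<in>B. d j * z powi j)"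
    using g by (auto simp: laurent_span_def)
  let ?C = "(\<lambda>(i, j). i + j) ` (A \<times> B)"
  have "(\<lambda>z. \<Sum>i\<in>A. c i * (\<Sum>j\<in>B. d j * z powi (i + j))) \<in> laurent_span ?C"
  proof (intro laurent_span_sum laurent_span_scale laurent_span_monomial)
    fix i j assume "i \<in> A" "j \<in> B"
    then show "i + j \<in> ?C" by force
  qed (use f g in simp)
  then show ?thesis
  proof (rule laurent_span_cong[rotated])
    fix z :: complex assume z: "z \<noteq> 0"
    have "f z * g z = (\<Sum>i\<in>A. \<Sum>j\<in>B. (c i * z powi i) * (d j * z powi j))"
      by (simp only: c[OF z] d[OF z] sum_product)
    also have "\<dots> = (\<Sum>i\<in>A. c i * (\<Sum>j\<in>B. d j * z powi (i + j)))"
      using z by (intro sum.cong refl) (simp add: sum_distrib_left power_int_add mult_ac)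
    finally show "f z * g z = (\<Sum>i\<in>A. c i * (\<Sum>j\<in>B. d j * z powi (i + j)))" .
  qed
qed

text \<open>
  On the circle \<open>Re z = (z + 1/z) / 2\<close> and \<open>Im z = (z - 1/z) / (2 \<i>)\<close>, and a real-linear functional is a
  combination of these two.
\<close>

lemma real_linear_on_circle:
  fixes h :: "complex \<Rightarrow> real"
  assumes h: "bounded_linear h" and z: "z \<in> unit_circle"
  shows "complex_of_real (h z) = (of_real (h 1) - \<i> * of_real (h \<i>)) / 2 * z powi 1
    + (of_real (h 1) + \<i> * of_real (h \<i>)) / 2 * z powi (- 1)"
proof -
  interpret h: bounded_linear h by (rule h)
  have "h z = h (Re z *\<^sub>R 1 + Im z *\<^sub>R \<i>)"
    by (rule arg_cong[where f = h]) (simp add: complex_eq_iff)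
  also have "\<dots> = Re z * h 1 + Im z * h \<i>"
    by (simp only: h.add h.scaleR real_scaleR_def)
  finally have hz: "h z = Re z * h 1 + Im z * h \<i>" .
  have "z * cnj z = 1"
    using z by (simp add: complex_norm_square[symmetric])
  then have inv: "z powi (- 1) = cnj z"
    by (simp add: power_int_minus inverse_unique)
  show ?thesis
    unfolding inv hz by (simp add: complex_eq_iff field_simps)
qed

lemma real_polynomial_laurent_on_circle:
  assumes "real_polynomial_function p"
  shows "\<exists>A f. finite A \<and> f \<in> laurent_span A \<and> (\<forall>z\<in>unit_circle. complex_of_real (p z) = f z)"
  using assms
proof (induction p rule: real_polynomial_function.induct)
  case (linear h)
  let ?f = "\<lambda>z. (of_real (h 1) - \<i> * of_real (h \<i>)) / 2 * z powi 1
    + (of_real (h 1) + \<i> * of_real (h \<i>)) / 2 * z powi (- 1)"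
  have "?f \<in> laurent_span {1, - 1}"
    by (intro laurent_span_add laurent_span_scale laurent_span_monomial) auto
  moreover have "\<forall>z\<in>unit_circle. complex_of_real (h z) = ?f z"
    using real_linear_on_circle[OF linear] by blast
  ultimately show ?case
    by (intro exI[of _ "{1, - 1}"] exI[of _ ?f] conjI) (assumption | intro finite.intros)+
next
  case (const a)
  have "(\<lambda>z. complex_of_real a * z powi 0) \<in> laurent_span {0}"
    by (intro laurent_span_scale laurent_span_monomial) auto
  then show ?case
    by (intro exI[of _ "{0}"] exI[of _ "\<lambda>z. complex_of_real a * z powi 0"]) simp
next
  case (add p q)
  then obtain A f B g where
    f: "finite A" "f \<in> laurent_span A" "\<forall>z\<in>unit_circle. complex_of_real (p z) = f z" and
    g: "finite B" "g \<in> laurent_span B" "\<forall>z\<in>unit_circle. complex_of_real (q z) = g z"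
    by (elim exE conjE)
  have "(\<lambda>z. f z + g z) \<in> laurent_span (A \<union> B)"
    by (intro laurent_span_add laurent_span_mono[OF f(2)] laurent_span_mono[OF g(2)])
      (use f(1) g(1) in auto)
  then show ?case
    using f g by (intro exI[of _ "A \<union> B"] exI[of _ "\<lambda>z. f z + g z"]) simp
next
  case (mult p q)
  then obtain A f B g where
    f: "finite A" "f \<in> laurent_span A" "\<forall>z\<in>unit_circle. complex_of_real (p z) = f z" and
    g: "finite B" "g \<in> laurent_span B" "\<forall>z\<in>unit_circle. complex_of_real (q z) = g z"
    by (elim exE conjE)
  have "(\<lambda>z. f z * g z) \<in> laurent_span ((\<lambda>(i, j). i + j) ` (A \<times> B))"
    by (rule laurent_span_mult[OF f(2,1) g(2,1)])
  then show ?case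
    using f g
    by (intro exI[of _ "(\<lambda>(i, j). i + j) ` (A \<times> B)"] exI[of _ "\<lambda>z. f z * g z"]) simp
qed

lemma (in circle_prob_space) integral_laurent:
  assumes "\<And>z. z \<noteq> 0 \<Longrightarrow> f z = (\<Sum>j\<in>A. c j * z powi j)"
  shows "(\<integral>z. f z \<partial>M) = (\<Sum>j\<in>A. c j * (\<integral>z. z powi j \<partial>M))"
proof -
  have "(\<integral>z. f z \<partial>M) = (\<integral>z. (\<Sum>j\<in>A. c j * z powi j) \<partial>M)"
    by (intro Bochner_Integration.integral_cong refl assms) (auto simp: space_circle)
  also have "\<dots> = (\<Sum>j\<in>A. c j * (\<integral>z. z powi j \<partial>M))"
    using integrable_laurent[OF monomial_laurent_span] by (simp add: integral_sum)
  finally show ?thesis .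
qed

text \<open>
  The functions \<open>max 0 (1 - n infdist z C)\<close> are continuous, bounded by 1 and decrease to the indicator
  function of \<open>C\<close>. The set must be nonempty because \<open>infdist z {} = 0\<close>.
\<close>

lemma (in circle_prob_space) measure_closed_limit:
  assumes C: "closed C" "C \<noteq> {}"
  shows "(\<lambda>n. \<integral>z. max 0 (1 - real n * infdist z C) \<partial>M) \<longlonglongrightarrow> measure M (C \<inter> space M)"
proof -
  have cont: "continuous_on unit_circle (\<lambda>z. max 0 (1 - real n * infdist z C))" for n
    by (intro continuous_intros)
  have C_sets: "C \<inter> space M \<in> sets M"
    using C(1) by (auto simp: space_circle sets_circle circle_borel_def sets_restrict_space)
  have "(\<lambda>n. \<integral>z. max 0 (1 - real n * infdist z C) \<partial>M)
      \<longlonglongrightarrow> (\<integral>z. indicator (C \<inter> space M) z \<partial>M)"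
  proof (rule integral_dominated_convergence[where w = "\<lambda>z. 1"])
    show "(\<lambda>z. indicator (C \<inter> space M) z :: real) \<in> borel_measurable M"
      using C_sets by simp
    show "(\<lambda>z. max 0 (1 - real n * infdist z C)) \<in> borel_measurable M" for n
      using integrable_continuous[OF cont] by (rule borel_measurable_integrable)
    show "AE z in M. (\<lambda>n. max 0 (1 - real n * infdist z C)) \<longlonglongrightarrow> indicator (C \<inter> space M) z"
    proof (rule AE_I2)
      fix z assume z: "z \<in> space M"
      show "(\<lambda>n. max 0 (1 - real n * infdist z C)) \<longlonglongrightarrow> indicator (C \<inter> space M) z"
      proof (cases "z \<in> C")
        case True
        then show ?thesis using z by simp
      next
        case False
        then have pos: "infdist z C > 0"
          using C by (simp add: infdist_pos_not_in_closed)
        have "eventually (\<lambda>n. max 0 (1 - real n * infdist z C) = 0) sequentially"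
          using eventually_gt_at_top[of "nat \<lceil>1 / infdist z C\<rceil>"]
        proof eventually_elim
          case (elim n)
          then have "1 / infdist z C \<le> real n" by linarith
          then show ?case using pos by (simp add: field_simps)
        qed
        then show ?thesis
          using False by (simp add: tendsto_eventually)
      qed
    qed
    show "AE z in M. norm (max 0 (1 - real n * infdist z C)) \<le> 1" for n
      by (rule AE_I2) (simp add: infdist_nonneg)
  qed simp
  then show ?thesis by simp
qed

text \<open>
  Equal moments give equal integrals of real polynomials in \<open>Re z\<close> and \<open>Im z\<close>, by Stone-Weierstrass of
  all continuous functions, and in the limit equal measures of closed sets, which form an
  intersection-stable generator of the Borel sets of the plane. Pushing both measures forward to the plane
  makes this generator available.
\<close>

lemma circle_measure_eqI_moments:
  assumes "circle_prob_space M" "circle_prob_space N"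
    and moments: "\<And>k. (\<integral>z. z powi k \<partial>M) = (\<integral>z. z powi k \<partial>N)"
  shows "M = N"
proof -
  interpret M: circle_prob_space M by fact
  interpret N: circle_prob_space N by fact
  have poly: "(\<integral>z. p z \<partial>M) = (\<integral>z. p z \<partial>N)" if p: "real_polynomial_function p" for p
  proof -
    obtain A f where f: "finite A" "f \<in> laurent_span A"
        "\<forall>z\<in>unit_circle. complex_of_real (p z) = f z"
      using real_polynomial_laurent_on_circle[OF p] by (elim exE conjE)
    obtain c where c: "\<And>z. z \<noteq> 0 \<Longrightarrow> f z = (\<Sum>j\<in>A. c j * z powi j)"
      using f(2) by (auto simp: laurent_span_def)
    have "complex_of_real (\<integral>z. p z \<partial>M) = (\<integral>z. f z \<partial>M)"
      unfolding integral_complex_of_real[symmetric]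
      by (intro Bochner_Integration.integral_cong refl) (use f(3) in \<open>simp add: M.space_circle\<close>)
    also have "(\<integral>z. f z \<partial>M) = (\<Sum>j\<in>A. c j * (\<integral>z. z powi j \<partial>M))"
      by (rule M.integral_laurent) (rule c)
    also have "\<dots> = (\<Sum>j\<in>A. c j * (\<integral>z. z powi j \<partial>N))"
      by (simp only: moments)
    also have "\<dots> = (\<integral>z. f z \<partial>N)"
      by (rule N.integral_laurent[symmetric]) (rule c)
    also have "\<dots> = complex_of_real (\<integral>z. p z \<partial>N)"
      unfolding integral_complex_of_real[symmetric]
      by (intro Bochner_Integration.integral_cong refl) (use f(3) in \<open>simp add: N.space_circle\<close>)
    finally show ?thesis by simp
  qed
  have cont: "(\<integral>z. f z \<partial>M) = (\<integral>z. f z \<partial>N)"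
    if f: "continuous_on unit_circle f" for f :: "complex \<Rightarrow> real"
  proof (rule ccontr)
    assume neq: "(\<integral>z. f z \<partial>M) \<noteq> (\<integral>z. f z \<partial>N)"
    define e where "e = \<bar>(\<integral>z. f z \<partial>M) - (\<integral>z. f z \<partial>N)\<bar> / 2"
    have "e > 0" using neq by (simp add: e_def)
    have "compact unit_circle" by simp
    then obtain p where p: "real_polynomial_function p"
        "\<And>z. z \<in> unit_circle \<Longrightarrow> \<bar>f z - p z\<bar> < e / 2"
      using Stone_Weierstrass_real_polynomial_function[OF _ f half_gt_zero[OF \<open>e > 0\<close>]] by blast
    have p_cont: "continuous_on unit_circle p"
      using p(1) by (simp add: continuous_on_polymonial_function real_polynomial_function_eq)
    have close: "\<bar>(\<integral>z. f z \<partial>L) - (\<integral>z. p z \<partial>L)\<bar> \<le> e / 2" if "circle_prob_space L" for L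
    proof -
      interpret L: circle_prob_space L by fact
      note int = L.integrable_continuous[OF f] L.integrable_continuous[OF p_cont]
      have "\<bar>(\<integral>z. f z \<partial>L) - (\<integral>z. p z \<partial>L)\<bar> = \<bar>\<integral>z. f z - p z \<partial>L\<bar>"
        using int by simp
      also have "\<dots> \<le> (\<integral>z. \<bar>f z - p z\<bar> \<partial>L)"
        by (rule integral_abs_bound)
      also have "\<dots> \<le> (\<integral>z. e / 2 \<partial>L)"
      proof (rule integral_mono)
        show "\<bar>f z - p z\<bar> \<le> e / 2" if "z \<in> space L" for z
          using p(2)[of z] that by (simp only: L.space_circle less_imp_le)
      qed (use int in auto)
      finally show ?thesis using L.prob_space by simp
    qed
    have "\<bar>(\<integral>z. f z \<partial>M) - (\<integral>z. f z \<partial>N)\<bar> \<le> e"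
      using close[OF assms(1)] close[OF assms(2)] poly[OF p(1)] by linarith
    with \<open>e > 0\<close> show False by (simp add: e_def)
  qed
  have closed: "measure M (C \<inter> space M) = measure N (C \<inter> space N)" if C: "closed C" for C
  proof (cases "C = {}")
    case False
    have eq: "(\<integral>z. max 0 (1 - real n * infdist z C) \<partial>M)
        = (\<integral>z. max 0 (1 - real n * infdist z C) \<partial>N)" for n
      by (intro cont continuous_intros)
    have "(\<lambda>n. \<integral>z. max 0 (1 - real n * infdist z C) \<partial>M) \<longlonglongrightarrow> measure N (C \<inter> space N)"
      unfolding eq by (rule N.measure_closed_limit[OF C False])
    with M.measure_closed_limit[OF C False] show ?thesis
      by (rule LIMSEQ_unique)
  qed simp
  have into_borel: "(\<lambda>z. z) \<in> measurable L borel" if "circle_prob_space L" for L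
  proof -
    interpret L: circle_prob_space L by fact
    show ?thesis
      using L.integrable_continuous[OF continuous_on_id] by (rule borel_measurable_integrable)
  qed
  note meas = into_borel[OF assms(1)] into_borel[OF assms(2)]
  have distr_eq: "distr M borel (\<lambda>z. z) = distr N borel (\<lambda>z. z)"
  proof (rule measure_eqI_generator_eq[where E = "Collect closed" and \<Omega> = UNIV and A = "\<lambda>_. UNIV"])
    fix C :: "complex set" assume "C \<in> Collect closed"
    then have C: "closed C" "C \<in> sets borel" by auto
    show "emeasure (distr M borel (\<lambda>z. z)) C = emeasure (distr N borel (\<lambda>z. z)) C"
      using closed[OF C(1)] C(2) meas
      by (simp add: emeasure_distr M.emeasure_eq_measure N.emeasure_eq_measure vimage_def Int_def)
  next
    show "emeasure (distr M borel (\<lambda>z. z)) UNIV \<noteq> \<infinity>"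
      using meas by (simp add: emeasure_distr)
  qed (auto simp: Int_stable_def borel_eq_closed)
  show "M = N"
  proof (rule measure_eqI)
    show "sets M = sets N"
      by (simp add: M.sets_circle N.sets_circle)
    fix X assume X: "X \<in> sets M"
    then obtain B where B: "B \<in> sets borel" "X = unit_circle \<inter> B"
      unfolding M.sets_circle circle_borel_def sets_restrict_space by blast
    have "emeasure M X = emeasure (distr M borel (\<lambda>z. z)) B"
      using B meas by (simp add: emeasure_distr M.space_circle Int_commute)
    also have "\<dots> = emeasure N X"
      using B meas by (simp add: distr_eq emeasure_distr N.space_circle Int_commute)
    finally show "emeasure M X = emeasure N X" .
  qed
qed

section \<open>Moments of the Lebesgue measure\<close>

lemma cis_measurable: "cis \<in> measurable (uniform_measure lborel {0..<2 * pi}) circle_borel"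
  unfolding circle_borel_def
proof (rule measurable_restrict_space2)
  have "cis \<in> borel_measurable borel"
    by (intro borel_measurable_continuous_onI continuous_intros)
  then show "cis \<in> measurable (uniform_measure lborel {0..<2 * pi}) borel"
    by simp
qed simp

lemma circle_prob_space_lebesgue: "circle_prob_space lebesgue_circle"
proof -
  interpret U: prob_space "uniform_measure lborel {0..<2 * pi}"
    by (rule prob_space_uniform_measure) auto
  interpret L: prob_space lebesgue_circle
    unfolding lebesgue_circle_def by (rule U.prob_space_distr[OF cis_measurable])
  show ?thesis
    by unfold_locales (simp add: lebesgue_circle_def)
qed

lemma lebesgue_circle_moment:
  "(\<integral>z. z powi k \<partial>lebesgue_circle) = (if k = 0 then 1 else 0)"
proof (cases "k = 0")
  case True
  interpret L: circle_prob_space lebesgue_circle by (rule circle_prob_space_lebesgue)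
  show ?thesis using True L.prob_space by simp
next
  case False
  let ?f = "\<lambda>t. cis (of_int k * t)"
  let ?F = "\<lambda>t. ?f t / (\<i> * of_int k)"
  have [measurable]: "?f \<in> borel_measurable borel"
    by (intro borel_measurable_continuous_onI continuous_intros)
  have density: "uniform_measure lborel {0..<2 * pi}
      = density lborel (\<lambda>t. ennreal (indicator {0..<2 * pi} t / (2 * pi)))"
    unfolding uniform_measure_def
    by (intro arg_cong[where f = "density lborel"] ext)
       (simp add: ennreal_indicator[symmetric] divide_ennreal split: split_indicator)
  have "(\<integral>z. z powi k \<partial>lebesgue_circle)
      = (\<integral>t. cis t powi k \<partial>uniform_measure lborel {0..<2 * pi})"
    unfolding lebesgue_circle_def
  proof (rule integral_distr[OF cis_measurable])
    interpret L: circle_prob_space lebesgue_circle by (rule circle_prob_space_lebesgue)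
    show "(\<lambda>z. z powi k) \<in> borel_measurable circle_borel"
      using L.integrable_laurent[OF monomial_laurent_span, THEN borel_measurable_integrable]
      by (simp add: measurable_cong_sets[OF L.sets_circle refl])
  qed
  also have "\<dots> = (\<integral>t. (indicator {0..<2 * pi} t / (2 * pi)) *\<^sub>R ?f t \<partial>lborel)"
    unfolding density cis_power_int
  proof (rule integral_density)
    show "?f \<in> borel_measurable lborel" by measurable
  qed (auto intro!: AE_I2 split: split_indicator)
  also have "\<dots> = (\<integral>t. (1 / (2 * pi)) *\<^sub>R (indicator {0..2 * pi} t *\<^sub>R ?f t) \<partial>lborel)"
  proof (rule integral_cong_AE)
    show "(\<lambda>t. (indicator {0..<2 * pi} t / (2 * pi)) *\<^sub>R ?f t) \<in> borel_measurable lborel"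
      by measurable
    show "(\<lambda>t. (1 / (2 * pi)) *\<^sub>R (indicator {0..2 * pi} t *\<^sub>R ?f t)) \<in> borel_measurable lborel"
      by measurable
    show "AE t in lborel. (indicator {0..<2 * pi} t / (2 * pi)) *\<^sub>R ?f t
        = (1 / (2 * pi)) *\<^sub>R (indicator {0..2 * pi} t *\<^sub>R ?f t)"
      using AE_lborel_singleton[of "2 * pi"]
      by eventually_elim (auto split: split_indicator)
  qed
  also have "\<dots> = (1 / (2 * pi)) *\<^sub>R (\<integral>t. indicator {0..2 * pi} t *\<^sub>R ?f t \<partial>lborel)"
    by (rule integral_scaleR_right)
  also have "(\<integral>t. indicator {0..2 * pi} t *\<^sub>R ?f t \<partial>lborel) = ?F (2 * pi) - ?F 0"
  proof (rule integral_FTC_atLeastAtMost)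
    show "(?F has_vector_derivative ?f t) (at t within {0..2 * pi})" for t
    proof -
      have "((\<lambda>z. exp (\<i> * of_int k * z) / (\<i> * of_int k)) has_field_derivative
          exp (\<i> * of_int k * of_real t)) (at (of_real t))"
        using False by (auto intro!: derivative_eq_intros)
      from has_vector_derivative_real_field[OF this, of "{0..2 * pi}"]
      show ?thesis by (simp add: cis_conv_exp mult_ac)
    qed
    show "continuous_on {0..2 * pi} ?f" by (intro continuous_intros)
  qed simp
  also have "?F (2 * pi) - ?F 0 = 0"
    using cis_multiple_2pi[of "of_int k"] by (simp add: mult_ac)
  finally show ?thesis using False by simp
qed

section \<open>Second-order operators acting on Laurent polynomials\<close>

text \<open>
  The exponents enter through a function \<open>p\<close> because differentiating once turns the index \<open>j\<close> into
  the exponent \<open>j - 1\<close> while keeping the index set; the lemma thereby applies to its own result.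
\<close>

lemma deriv_laurent:
  assumes f: "\<And>z. z \<noteq> 0 \<Longrightarrow> f z = (\<Sum>j\<in>A. c j * z powi (p j))" and z: "z \<noteq> 0"
  shows "deriv f z = (\<Sum>j\<in>A. c j * of_int (p j) * z powi (p j - 1))"
proof -
  have ev: "eventually (\<lambda>z. f z = (\<Sum>j\<in>A. c j * z powi (p j))) (nhds z)"
    using t1_space_nhds[OF z] by eventually_elim (rule f)
  have "((\<lambda>z. \<Sum>j\<in>A. c j * z powi (p j)) has_field_derivative
      (\<Sum>j\<in>A. c j * of_int (p j) * z powi (p j - 1))) (at z)"
  proof (rule DERIV_sum)
    fix j
    have "((\<lambda>z. z powi p j) has_field_derivative of_int (p j) * z powi (p j - 1)) (at z)"
      using DERIV_power_int[OF DERIV_ident, of "p j" z] z by simp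
    from DERIV_cmult[OF this, of "c j"]
    show "((\<lambda>z. c j * z powi p j) has_field_derivative c j * of_int (p j) * z powi (p j - 1)) (at z)"
      by (simp only: mult.assoc)
  qed
  then have "deriv (\<lambda>z. \<Sum>j\<in>A. c j * z powi (p j)) z
      = (\<Sum>j\<in>A. c j * of_int (p j) * z powi (p j - 1))"
    by (rule DERIV_imp_deriv)
  then show ?thesis
    using deriv_cong_ev[OF ev refl] by simp
qed

definition monomial_image ::
  "(nat \<Rightarrow> complex \<Rightarrow> complex) \<Rightarrow> int \<Rightarrow> complex \<Rightarrow> complex" where
  "monomial_image D j z = D 0 z * z powi j + D 1 z * (of_int j * z powi (j - 1))
     + D 2 z * (of_int (j * (j - 1)) * z powi (j - 2))"

lemma diff_op_laurent:
  assumes f: "\<And>z. z \<noteq> 0 \<Longrightarrow> f z = (\<Sum>j\<in>A. c j * z powi j)" and z: "z \<noteq> 0"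
  shows "diff_op D 2 f z = (\<Sum>j\<in>A. c j * monomial_image D j z)"
proof -
  have f': "deriv f z = (\<Sum>j\<in>A. c j * of_int j * z powi (j - 1))" if "z \<noteq> 0" for z
    by (rule deriv_laurent[where p = "\<lambda>j. j"]) (rule f that, assumption?)+
  have f'': "deriv (deriv f) z = (\<Sum>j\<in>A. c j * of_int j * of_int (j - 1) * z powi (j - 1 - 1))"
    by (rule deriv_laurent[where p = "\<lambda>j. j - 1"]) (rule f' z, assumption?)+
  have "{..2::nat} = {0, 1, 2}" by auto
  then have "diff_op D 2 f z = D 0 z * f z + D 1 z * deriv f z + D 2 z * deriv (deriv f) z"
    by (simp add: diff_op_def numeral_2_eq_2)
  also have "\<dots> = (\<Sum>j\<in>A. c j * monomial_image D j z)"
    unfolding f[OF z] f'[OF z] f'' sum_distrib_left sum.distrib[symmetric]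
    by (intro sum.cong refl) (simp add: monomial_image_def algebra_simps)
  finally show ?thesis .
qed

lemma diff_op_monomial:
  assumes "z \<noteq> 0"
  shows "diff_op D 2 (\<lambda>z. z powi j) z = monomial_image D j z"
  using diff_op_laurent[where f = "\<lambda>z. z powi j" and A = "{j}" and c = "\<lambda>_. 1"] assms by simp

lemma diff_op_linear_combination:
  assumes f: "\<And>k. k \<in> K \<Longrightarrow> f k \<in> laurent_span A"
    and g: "\<And>z. z \<noteq> 0 \<Longrightarrow> g z = (\<Sum>k\<in>K. h k * f k z)" and z: "z \<noteq> 0"
  shows "diff_op D 2 g z = (\<Sum>k\<in>K. h k * diff_op D 2 (f k) z)"
proof -
  have "\<forall>k\<in>K. \<exists>c. \<forall>z. z \<noteq> 0 \<longrightarrow> f k z = (\<Sum>j\<in>A. c j * z powi j)"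
    using f by (auto simp: laurent_span_def)
  then obtain c where c: "\<And>k z. k \<in> K \<Longrightarrow> z \<noteq> 0 \<Longrightarrow> f k z = (\<Sum>j\<in>A. c k j * z powi j)"
    unfolding bchoice_iff by blast
  have "g z = (\<Sum>j\<in>A. (\<Sum>k\<in>K. h k * c k j) * z powi j)" if z: "z \<noteq> 0" for z
  proof -
    have "g z = (\<Sum>k\<in>K. \<Sum>j\<in>A. h k * c k j * z powi j)"
      unfolding g[OF z] by (intro sum.cong refl) (simp add: c z sum_distrib_left mult.assoc)
    also have "\<dots> = (\<Sum>j\<in>A. (\<Sum>k\<in>K. h k * c k j) * z powi j)"
      by (subst sum.swap) (simp add: sum_distrib_right)
    finally show ?thesis .
  qed
  then have "diff_op D 2 g z = (\<Sum>j\<in>A. (\<Sum>k\<in>K. h k * c k j) * monomial_image D j z)"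
    using z by (rule diff_op_laurent)
  also have "\<dots> = (\<Sum>k\<in>K. \<Sum>j\<in>A. h k * c k j * monomial_image D j z)"
    by (subst sum.swap) (simp add: sum_distrib_right)
  also have "\<dots> = (\<Sum>k\<in>K. h k * diff_op D 2 (f k) z)"
  proof (rule sum.cong[OF refl])
    fix k assume "k \<in> K"
    have "diff_op D 2 (f k) z = (\<Sum>j\<in>A. c k j * monomial_image D j z)"
      by (rule diff_op_laurent[OF c[OF \<open>k \<in> K\<close>] z])
    then show "(\<Sum>j\<in>A. h k * c k j * monomial_image D j z) = h k * diff_op D 2 (f k) z"
      by (simp add: sum_distrib_left mult.assoc)
  qed
  finally show ?thesis .
qed

text \<open>
  With \<open>q\<^sub>j(z) = D z\<^sup>j / z\<^sup>j\<close>, the hypothesis says that the exponents of \<open>q\<^sub>j\<close> are nonpositive for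
  \<open>j \<ge> 0\<close> and nonnegative for \<open>j \<le> 0\<close>. Since \<open>q\<^sub>j\<close> is quadratic in \<open>j\<close>, its third differences vanish.
  The differences at \<open>-1, \<dots>, 2\<close> and \<open>-2, \<dots>, 1\<close> then express \<open>q\<^sub>-\<^sub>1\<close> through indices \<open>\<ge> 0\<close> and \<open>q\<^sub>1\<close>
  through indices \<open>\<le> 0\<close>. So \<open>q\<^sub>-\<^sub>1\<close>, \<open>q\<^sub>0\<close> and \<open>q\<^sub>1\<close> satisfy both bounds and are constant, and they
  determine the coefficients of the operator.
\<close>

lemma diagonal_of_symmetric_spans:
  assumes "\<And>j. \<bar>j\<bar> \<le> 2 \<Longrightarrow> monomial_image D j \<in> laurent_span {- \<bar>j\<bar>..\<bar>j\<bar>}"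
  obtains a b c where "\<And>z. z \<noteq> 0 \<Longrightarrow> D 0 z = a" "\<And>z. z \<noteq> 0 \<Longrightarrow> D 1 z = b * z"
    "\<And>z. z \<noteq> 0 \<Longrightarrow> D 2 z = c * z ^ 2"
proof -
  define q where "q = (\<lambda>j z. z powi (- j) * monomial_image D j z)"
  have q: "q j z = D 0 z + of_int j * (D 1 z / z) + of_int (j * (j - 1)) * (D 2 z / z ^ 2)"
    if "z \<noteq> 0" for j z
    using that by (simp add: q_def monomial_image_def power_int_diff power_int_minus field_simps)
  have q_span: "q j \<in> laurent_span {- \<bar>j\<bar> - j..\<bar>j\<bar> - j}" if "\<bar>j\<bar> \<le> 2" for j
    using laurent_span_shift[OF assms[OF that], of "- j"] by (simp add: q_def add.commute)
  have q_le: "q j \<in> laurent_span {-4..0}" if "0 \<le> j" "j \<le> 2" for j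
    using that by (intro laurent_span_mono[OF q_span]) auto
  have q_ge: "q j \<in> laurent_span {0..4}" if "- 2 \<le> j" "j \<le> 0" for j
    using that by (intro laurent_span_mono[OF q_span]) auto
  have const: "f z = f 1" if "f \<in> laurent_span {-4..0}" "f \<in> laurent_span {0..4}" "z \<noteq> 0" for f z
  proof -
    have "f \<in> laurent_span ({-4..0} \<inter> {0..4})"
      using that by (intro laurent_span_Int) auto
    also have "{-4..0} \<inter> {0..4} = {0 :: int}" by auto
    finally show ?thesis using that(3) by (rule laurent_span_constant)
  qed
  \<comment> \<open>the third difference at \<open>-1, 0, 1, 2\<close>, solved for \<open>q (-1)\<close>\<close>
  have "(\<lambda>z. q 2 z + 3 * q 0 z - 3 * q 1 z) \<in> laurent_span {-4..0}"
    by (intro laurent_span_add laurent_span_diff laurent_span_scale q_le) auto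
  then have q_m1_le: "q (- 1) \<in> laurent_span {-4..0}"
    by (rule laurent_span_cong[rotated]) (simp add: q algebra_simps)
  have q_m1: "q (- 1) z = q (- 1) 1" if "z \<noteq> 0" for z
    by (rule const[OF q_m1_le q_ge that]) auto
  \<comment> \<open>the third difference at \<open>-2, -1, 0, 1\<close>, solved for \<open>q 1\<close>\<close>
  have "(\<lambda>z. q (- 2) z + 3 * q 0 z - 3 * q (- 1) z) \<in> laurent_span {0..4}"
    by (intro laurent_span_add laurent_span_diff laurent_span_scale q_ge) auto
  then have q_1_ge: "q 1 \<in> laurent_span {0..4}"
    by (rule laurent_span_cong[rotated]) (simp add: q algebra_simps)
  have q_1: "q 1 z = q 1 1" if "z \<noteq> 0" for z
    by (rule const[OF q_le q_1_ge that]) auto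
  have q_0: "q 0 z = q 0 1" if "z \<noteq> 0" for z
    by (rule const[OF q_le q_ge that]) auto
  show ?thesis
  proof (rule that[of "q 0 1" "q 1 1 - q 0 1" "(q (- 1) 1 + q 1 1) / 2 - q 0 1"])
    fix z :: complex assume z: "z \<noteq> 0"
    show "D 0 z = q 0 1"
      using q_0[OF z] q[OF z, of 0] by simp
    have "D 1 z / z = q 1 z - q 0 z"
      using q[OF z, of 1] q[OF z, of 0] by simp
    then show "D 1 z = (q 1 1 - q 0 1) * z"
      using z by (simp add: q_1[OF z] q_0[OF z] field_simps)
    have "D 2 z / z ^ 2 = (q (- 1) z + q 1 z) / 2 - q 0 z"
      using q[OF z, of 1] q[OF z, of 0] q[OF z, of "- 1"] by (simp add: add_divide_distrib)
    then show "D 2 z = ((q (- 1) 1 + q 1 1) / 2 - q 0 1) * z ^ 2"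
      using z by (simp add: q_1[OF z] q_0[OF z] q_m1[OF z] field_simps)
  qed
qed

section \<open>Operators with the orthonormal Laurent polynomials as eigenfunctions\<close>

context circle_prob_space
begin

text \<open>
  Reading Gram-Schmidt backwards, the \<open>n\<close>-th monomial is a combination of \<open>x\<^sub>0, \<dots>, x\<^sub>n\<close>, and the
  operator multiplies each of these by a scalar.
\<close>

lemma monomial_image_span:
  assumes inf: "infinite (measure_support M)" and eig: "\<And>k. is_eigenfunction D 2 (olp M k)"
  shows "monomial_image D (laurent_exponent n) \<in> laurent_span (laurent_exponent ` {..n})"
proof -
  let ?e = "\<lambda>z::complex. z powi laurent_exponent n"
  let ?E = "laurent_exponent ` {..n}"
  define h where "h = (\<lambda>k. if k = n then complex_of_real (L2_norm M (residual n))
    else L2_inner M ?e (olp M k))"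
  obtain l where l: "\<And>k z. z \<noteq> 0 \<Longrightarrow> diff_op D 2 (olp M k) z = l k * olp M k z"
    using eig unfolding is_eigenfunction_def by metis
  have span: "olp M k \<in> laurent_span ?E" if "k \<in> {..n}" for k
    using that by (intro laurent_span_mono[OF olp_span]) auto
  have e: "?e z = (\<Sum>k\<in>{..n}. h k * olp M k z)" for z
  proof -
    have "(\<Sum>k\<in>{..n}. h k * olp M k z)
        = h n * olp M n z + (\<Sum>k<n. L2_inner M ?e (olp M k) * olp M k z)"
      by (simp add: lessThan_Suc_atMost[symmetric] h_def)
    then show ?thesis
      using L2_norm_residual[OF inf, of n] by (simp add: h_def olp_eq[of n] residual_def[of n z])
  qed
  have "(\<lambda>z. \<Sum>k\<in>{..n}. (h k * l k) * olp M k z) \<in> laurent_span ?E"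
    by (intro laurent_span_sum laurent_span_scale span)
  then show ?thesis
  proof (rule laurent_span_cong[rotated])
    fix z :: complex assume z: "z \<noteq> 0"
    have "monomial_image D (laurent_exponent n) z = (\<Sum>k\<in>{..n}. h k * diff_op D 2 (olp M k) z)"
      unfolding diff_op_monomial[OF z, symmetric]
      by (rule diff_op_linear_combination[OF span e z])
    then show "monomial_image D (laurent_exponent n) z = (\<Sum>k\<in>{..n}. (h k * l k) * olp M k z)"
      by (simp add: l[OF z] mult.assoc)
  qed
qed

lemma eigenoperator_diagonal:
  assumes inf: "infinite (measure_support M)" and eig: "\<And>k. is_eigenfunction D 2 (olp M k)"
  obtains a b c where "\<And>z. z \<noteq> 0 \<Longrightarrow> D 0 z = a" "\<And>z. z \<noteq> 0 \<Longrightarrow> D 1 z = b * z"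
    "\<And>z. z \<noteq> 0 \<Longrightarrow> D 2 z = c * z ^ 2"
proof (rule diagonal_of_symmetric_spans)
  fix j :: int
  obtain n where n: "laurent_exponent n = j"
  proof (cases "j \<ge> 0")
    case True
    then show ?thesis using that[of "2 * nat j"] by (simp add: laurent_exponent_even)
  next
    case False
    then show ?thesis
      using that[of "2 * nat (- j - 1) + 1"] by (simp only: laurent_exponent_odd)
  qed
  have "laurent_exponent ` {..n} \<subseteq> {- \<bar>j\<bar>..\<bar>j\<bar>}"
  proof
    fix i assume "i \<in> laurent_exponent ` {..n}"
    then have "\<bar>i\<bar> \<le> \<bar>j\<bar>" using laurent_exponent_abs_mono[of _ n] n by auto
    then show "i \<in> {- \<bar>j\<bar>..\<bar>j\<bar>}" by auto
  qed
  then show "monomial_image D j \<in> laurent_span {- \<bar>j\<bar>..\<bar>j\<bar>}"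
    using laurent_span_mono[OF monomial_image_span[OF inf eig, of n]] by (simp add: n)
qed (rule that)

lemma olp_leading:
  assumes inf: "infinite (measure_support M)"
    and c: "\<And>z. z \<noteq> 0 \<Longrightarrow> olp M n z = (\<Sum>j\<in>A. c j * z powi j)" and A: "finite A"
  shows "c (laurent_exponent n) \<noteq> 0"
proof -
  let ?A = "{j \<in> A. c j \<noteq> 0}"
  have "olp M n \<in> laurent_span ?A"
  proof (rule laurent_spanI)
    fix z :: complex assume "z \<noteq> 0"
    then show "olp M n z = (\<Sum>j\<in>?A. c j * z powi j)"
      unfolding c[OF \<open>z \<noteq> 0\<close>] using A by (intro sum.mono_neutral_right) auto
  qed
  from laurent_span_scale[OF this, of "complex_of_real (L2_norm M (residual n))"]
  have "residual n \<in> laurent_span ?A"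
    by (rule laurent_span_cong[rotated]) (simp add: olp_eq L2_norm_residual[OF inf])
  from residual_leading[OF this] A
  show ?thesis by auto
qed

text \<open>
  Comparing coefficients in \<open>D x\<^sub>n = \<lambda> x\<^sub>n\<close> leaves in \<open>x\<^sub>n\<close> only monomials whose \<open>\<kappa>\<close> equals that of the
  leading one. If no earlier monomial qualifies, \<open>x\<^sub>n\<close> is a multiple of its leading monomial, which
  is then orthogonal to \<open>x\<^sub>0 = 1\<close>.
\<close>

lemma moment_zero_if_resonance_free:
  assumes inf: "infinite (measure_support M)" and n: "n > 0"
    and eig: "is_eigenfunction D 2 (olp M n)"
    and diag: "\<And>j z. z \<noteq> 0 \<Longrightarrow> monomial_image D j z = \<kappa> j * z powi j"
    and free: "\<And>k. k < n \<Longrightarrow> \<kappa> (laurent_exponent k) \<noteq> \<kappa> (laurent_exponent n)"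
  shows "(\<integral>z. z powi laurent_exponent n \<partial>M) = 0"
proof -
  let ?E = "laurent_exponent ` {..n}"
  let ?n = "laurent_exponent n"
  obtain d where d: "\<And>z. z \<noteq> 0 \<Longrightarrow> olp M n z = (\<Sum>j\<in>?E. d j * z powi j)"
    using olp_span[of n] unfolding laurent_span_def by blast
  have lead: "d ?n \<noteq> 0"
    by (rule olp_leading[OF inf d]) auto
  obtain l where l: "\<And>z. z \<noteq> 0 \<Longrightarrow> diff_op D 2 (olp M n) z = l * olp M n z"
    using eig unfolding is_eigenfunction_def by blast
  have eq: "(\<Sum>j\<in>?E. (d j * \<kappa> j) * z powi j) = (\<Sum>j\<in>?E. (l * d j) * z powi j)" if z: "z \<noteq> 0" for z
  proof -
    have "diff_op D 2 (olp M n) z = (\<Sum>j\<in>?E. d j * monomial_image D j z)"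
      by (rule diff_op_laurent) (rule d, assumption, rule z)
    then have "(\<Sum>j\<in>?E. (d j * \<kappa> j) * z powi j) = diff_op D 2 (olp M n) z"
      by (simp only: diag[OF z] mult.assoc)
    also have "\<dots> = (\<Sum>j\<in>?E. (l * d j) * z powi j)"
      unfolding l[OF z] d[OF z] by (simp only: sum_distrib_left mult.assoc)
    finally show ?thesis .
  qed
  have coeff: "d j * \<kappa> j = l * d j" if "j \<in> ?E" for j
    by (rule laurent_coeffs_unique[OF _ eq that]) simp_all
  have "\<kappa> ?n = l"
    using coeff[of ?n] lead by simp
  then have zero: "d j = 0" if "j \<in> ?E - {?n}" for j
    using coeff[of j] free that by (auto simp: le_less)
  have "olp M n z = (\<Sum>j\<in>{?n}. d j * z powi j)" if "z \<noteq> 0" for z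
    unfolding d[OF that] using zero by (intro sum.mono_neutral_right) auto
  then have "(\<integral>z. olp M n z \<partial>M) = d ?n * (\<integral>z. z powi ?n \<partial>M)"
    by (subst integral_laurent[where A = "{?n}" and c = d]) simp_all
  then show ?thesis
    using integral_olp[OF n] lead by simp
qed

lemma moment_uminus: "(\<integral>z. z powi (- k) \<partial>M) = cnj (\<integral>z. z powi k \<partial>M)"
proof -
  have "(\<integral>z. z powi (- k) \<partial>M) = (\<integral>z. cnj (z powi k) \<partial>M)"
    by (intro Bochner_Integration.integral_cong refl)
       (simp add: space_circle cnj_powi_circle del: complex_cnj_power_int)
  then show ?thesis by (simp del: complex_cnj_power_int)
qed

text \<open>
  Two distinct indices share a value of the quadratic \<open>\<kappa>\<close> only if their sum is one fixed number. A
  collision of \<open>m > 0\<close> with an earlier exponent makes this number nonnegative, a collision of \<open>-m\<close> with an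
  earlier exponent makes it negative. So at least one of \<open>m\<close> and \<open>-m\<close> is free of collisions and has
  vanishing moment; conjugation gives the other.
\<close>

lemma moments_zero_of_diagonal:
  assumes inf: "infinite (measure_support M)"
    and eig: "\<And>n. is_eigenfunction D 2 (olp M n)"
    and D: "\<And>z. z \<noteq> 0 \<Longrightarrow> D 0 z = a" "\<And>z. z \<noteq> 0 \<Longrightarrow> D 1 z = b * z"
      "\<And>z. z \<noteq> 0 \<Longrightarrow> D 2 z = c * z ^ 2"
    and bc: "b \<noteq> 0 \<or> c \<noteq> 0" and k: "k \<noteq> 0"
  shows "(\<integral>z. z powi k \<partial>M) = 0"
proof -
  define \<kappa> where "\<kappa> = (\<lambda>j::int. a + b * of_int j + c * of_int (j * (j - 1)))"
  have diag: "monomial_image D j z = \<kappa> j * z powi j" if "z \<noteq> 0" for j z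
    using that by (simp add: monomial_image_def D \<kappa>_def power_int_diff field_simps
        del: One_nat_def)
  have resonance: "b + c * of_int (i + j - 1) = 0" if "\<kappa> i = \<kappa> j" "i \<noteq> j" for i j
  proof -
    have "(of_int i - of_int j) * (b + c * of_int (i + j - 1)) = \<kappa> i - \<kappa> j"
      by (simp add: \<kappa>_def algebra_simps)
    then show ?thesis using that by simp
  qed
  have same_sum: "i + j = i' + j'"
    if "\<kappa> i = \<kappa> j" "i \<noteq> j" "\<kappa> i' = \<kappa> j'" "i' \<noteq> j'" for i j i' j'
  proof -
    have "c \<noteq> 0" using resonance[OF that(1,2)] bc by auto
    moreover have "c * of_int (i + j - 1) = c * of_int (i' + j' - 1)"
      using resonance[OF that(1,2)] resonance[OF that(3,4)] by (metis add_left_cancel)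
    ultimately show ?thesis by (simp only: mult_cancel_left of_int_eq_iff) simp
  qed
  note zero = moment_zero_if_resonance_free[OF inf _ eig diag]
  have "(\<integral>z. z powi int m \<partial>M) = 0" if m: "m > 0" for m
  proof (rule ccontr)
    assume nz: "(\<integral>z. z powi int m \<partial>M) \<noteq> 0"
    obtain i where i: "i < 2 * m" "\<kappa> (laurent_exponent i) = \<kappa> (int m)"
      using zero[of "2 * m"] nz m by (auto simp: laurent_exponent_even)
    obtain j where j: "j < 2 * (m - 1) + 1" "\<kappa> (laurent_exponent j) = \<kappa> (- int m)"
      using zero[of "2 * (m - 1) + 1"] nz m moment_uminus[of "int m"]
      unfolding laurent_exponent_odd by auto
    \<comment> \<open>\<open>-m\<close> precedes \<open>m\<close> in the ordering, but not conversely, hence the asymmetric bounds\<close>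
    have i': "- int m \<le> laurent_exponent i" "laurent_exponent i < int m"
      using i(1) unfolding laurent_exponent_def by auto
    have j': "- int m < laurent_exponent j" "laurent_exponent j < int m"
      using j(1) m unfolding laurent_exponent_def by (auto elim!: evenE oddE)
    have "laurent_exponent i + int m = laurent_exponent j + - int m"
      using i' j' by (intro same_sum i(2) j(2)) auto
    then show False using i' j' by linarith
  qed
  then have pos: "(\<integral>z. z powi l \<partial>M) = 0" if "l > 0" for l
    using that zero_less_imp_eq_int by metis
  show ?thesis
    using k pos[of k] pos[of "- k"] moment_uminus[of "- k"] by (cases "k > 0") auto
qed

end

text \<open>
  Orders one and two are treated together by regarding an operator of order one as one of order two with
  leading coefficient zero.
\<close>

lemma is_eigenfunction_pad:
  assumes "r \<le> 2"
  shows "is_eigenfunction (\<lambda>k z. if k \<le> r then D k z else 0) 2 f \<longleftrightarrow> is_eigenfunction D r f"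
proof -
  have "diff_op (\<lambda>k z. if k \<le> r then D k z else 0) 2 f z = diff_op D r f z" for z
    unfolding diff_op_def using assms by (intro sum.mono_neutral_cong_right) auto
  then show ?thesis by (simp add: is_eigenfunction_def)
qed

section \<open>The Lebesgue measure and the characterization\<close>

lemma olp_lebesgue_circle: "olp lebesgue_circle n = (\<lambda>z. z powi laurent_exponent n)"
proof (induction n rule: less_induct)
  case (less n)
  interpret circle_prob_space lebesgue_circle by (rule circle_prob_space_lebesgue)
  let ?e = "\<lambda>z::complex. z powi laurent_exponent n"
  have inner: "L2_inner lebesgue_circle ?e (olp lebesgue_circle k) = 0" if k: "k < n" for k
  proof -
    let ?d = "laurent_exponent n - laurent_exponent k"
    have "L2_inner lebesgue_circle ?e (olp lebesgue_circle k) = (\<integral>z. z powi ?d \<partial>lebesgue_circle)"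
      unfolding L2_inner_def
    proof (intro Bochner_Integration.integral_cong refl)
      fix z assume "z \<in> space lebesgue_circle"
      then have z: "cmod z = 1" by (simp add: space_circle)
      then have "z \<noteq> 0" by auto
      then show "?e z * cnj (olp lebesgue_circle k z) = z powi ?d"
        unfolding less.IH[OF k] cnj_powi_circle[OF z] by (simp add: power_int_add[symmetric])
    qed
    moreover have "?d \<noteq> 0"
      using laurent_exponent_inj[of n k] k by auto
    ultimately show ?thesis
      by (simp add: lebesgue_circle_moment)
  qed
  then have res: "residual n = ?e"
    by (simp add: fun_eq_iff residual_def)
  have "(\<integral>z. (cmod (?e z))\<^sup>2 \<partial>lebesgue_circle) = (\<integral>z. 1 \<partial>lebesgue_circle)"
    by (intro Bochner_Integration.integral_cong refl) (simp add: space_circle norm_power_int)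
  then have "L2_norm lebesgue_circle ?e = 1"
    using prob_space by (simp add: L2_norm_def)
  then show ?case
    by (simp add: fun_eq_iff olp_eq res)
qed

lemma is_eigenfunction_euler:
  "is_eigenfunction (\<lambda>k z. if k = 1 then z else 0) 1 (\<lambda>z. z powi j)"
  unfolding is_eigenfunction_def
proof (intro exI allI impI)
  fix z :: complex assume z: "z \<noteq> 0"
  have "deriv (\<lambda>z. z powi j) z = of_int j * z powi (j - 1)"
    using deriv_laurent[where f = "\<lambda>z. z powi j" and A = "{j}" and c = "\<lambda>_. 1" and p = "\<lambda>j. j"] z
    by simp
  then show "diff_op (\<lambda>k z. if k = 1 then z else 0) 1 (\<lambda>z. z powi j) z = of_int j * z powi j"
    using z by (simp add: diff_op_def power_int_diff)
qed

theorem theorem3p2: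
  fixes M :: "complex measure"
  assumes "prob_space M"
    and "sets M = sets circle_borel"
    and "infinite (measure_support M)"
  shows "(\<exists>r D. 1 \<le> r \<and> r \<le> 2 \<and> has_diff_order D r \<and> (\<forall>n. is_eigenfunction D r (olp M n)))
         \<longleftrightarrow> M = lebesgue_circle"
proof
  assume "\<exists>r D. 1 \<le> r \<and> r \<le> 2 \<and> has_diff_order D r \<and> (\<forall>n. is_eigenfunction D r (olp M n))"
  then obtain r D where r: "1 \<le> r" "r \<le> 2" and order: "has_diff_order D r"
    and eig: "\<And>n. is_eigenfunction D r (olp M n)"
    by blast
  interpret M: circle_prob_space M
    using assms(1,2) by (simp add: circle_prob_space_def circle_prob_space_axioms_def)
  interpret L: circle_prob_space lebesgue_circle
    by (rule circle_prob_space_lebesgue)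
  define D' where "D' = (\<lambda>k z. if k \<le> r then D k z else 0)"
  have eig': "is_eigenfunction D' 2 (olp M n)" for n
    unfolding D'_def is_eigenfunction_pad[OF r(2)] by (rule eig)
  obtain a b c where D': "\<And>z. z \<noteq> 0 \<Longrightarrow> D' 0 z = a" "\<And>z. z \<noteq> 0 \<Longrightarrow> D' 1 z = b * z"
    "\<And>z. z \<noteq> 0 \<Longrightarrow> D' 2 z = c * z ^ 2"
    using M.eigenoperator_diagonal[OF assms(3) eig'] by blast
  obtain w where w: "w \<noteq> 0" "D r w \<noteq> 0"
    using order unfolding has_diff_order_def by blast
  have "r = 1 \<or> r = 2" using r by auto
  then have bc: "b \<noteq> 0 \<or> c \<noteq> 0"
    using D'(2,3)[OF w(1)] w(2) by (auto simp: D'_def)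
  have "(\<integral>z. z powi k \<partial>M) = (\<integral>z. z powi k \<partial>lebesgue_circle)" for k
  proof (cases "k = 0")
    case True
    then show ?thesis using M.prob_space L.prob_space by simp
  next
    case False
    then show ?thesis
      using M.moments_zero_of_diagonal[OF assms(3) eig' D' bc False]
      by (simp add: lebesgue_circle_moment)
  qed
  then show "M = lebesgue_circle"
    by (rule circle_measure_eqI_moments[OF M.circle_prob_space_axioms L.circle_prob_space_axioms])
next
  assume M: "M = lebesgue_circle"
  show "\<exists>r D. 1 \<le> r \<and> r \<le> 2 \<and> has_diff_order D r \<and> (\<forall>n. is_eigenfunction D r (olp M n))"
  proof (intro exI conjI allI)
    show "has_diff_order (\<lambda>k z. if k = 1 then z else 0) 1"
      unfolding has_diff_order_def by (intro exI[of _ 1]) simp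
    show "is_eigenfunction (\<lambda>k z. if k = 1 then z else 0) 1 (olp M n)" for n
      unfolding M olp_lebesgue_circle by (rule is_eigenfunction_euler)
  qed simp_all
qed

end
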